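(* Consider the problem of minimizing $f(x)+g(z)$ subject to $Mx-z=0$, $x\in X$, $z\in Z$ (that is, $N=-I$), with optimal value $p^\star$. Let $\rho>0$ and suppose $f$ is twice continuously differentiable and $\hat L_f$-relatively smooth with respect to its Hessian $H_f$. Run GeNI-ADMM (see context) with $f_1=0$, $f_2=f$, $\Psi^k=0$ and $$\Theta^k=\eta(\hat H^k+\gamma^kI),\quad \eta=\hat L_f,\quad \gamma^k=\|E^k\|,\quad E^k=\hat H^k-H_f(\tilde x^k),$$ where $\hat H^k$ is a psd approximation of $H_f(\tilde x^k)$ (sketch-and-solve ADMM), with forcing sequences $\{\varepsilon_x^k\},\{\varepsilon_z^k\}$, started with $\tilde u^1=0$ and $M\tilde x^1=\tilde z^1$. Assume: (i) there is an optimal primal solution $(x^\star,z^\star)\in X\times Z$ and a $u^\star\in U$ such that $(x^\star,z^\star,u^\star)$ is a saddle point of $L_\rho$ over $(X\times Z)\times U$; (ii) $g$ is finite-valued, convex and lower semicontinuous; (iii) $\mathcal E_x=\sum_{k\ge1}\varepsilon_x^k<\infty$ and $\mathcal E_z=\sum_{k\ge1}\sqrt{\varepsilon_z^k}<\infty$; (iv) there are constants $\theta_{\max},\theta_{\min}>0$ with $\theta_{\max}I\succeq\Theta^k\succeq\theta_{\min}I$ for all $k\ge1$, and a non-negative summable sequence $\{\zeta^k\}_{k\ge1}$ with $\|\tilde x^k-x^\star\|^2_{\Theta^k}\le(1+\zeta^{k-1})\|\tilde x^k-x^\star\|^2_{\Theta^{k-1}}$ for all $k\ge2$. Put $\tau_\zeta=\prod_{k\ge2}(1+\zeta^k)$,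 $\mathcal E_\zeta=\tau_\zeta\sum_{k\ge1}\zeta^k$, $d_{x^\star,H_f(\tilde x^1)}=\|\tilde x^1-x^\star\|_{H_f(\tilde x^1)}$, $d_{x^\star}=\|\tilde x^1-x^\star\|$, $d_{z^\star}=\|\tilde z^1-z^\star\|$, $d_{u^\star}=\|\tilde u^1-u^\star\|$, and for $t\ge1$ let $\bar x^{t+1}=\frac1t\sum_{k=2}^{t+1}\tilde x^k$, $\bar z^{t+1}=\frac1t\sum_{k=2}^{t+1}\tilde z^k$. Then there exist constants $C_x,C_z,C_\zeta>0$, independent of $t$, such that with $$\hat\Gamma=\hat L_f\left(d^2_{x^\star,H_f(\tilde x^1)}+\|E^1\|d^2_{x^\star}\right)+\tfrac\rho2d^2_{z^\star}+C_x\mathcal E_x+C_z\mathcal E_z+C_\zeta\mathcal E_\zeta$$ one has for every $t\ge1$ $$f(\bar x^{t+1})+g(\bar z^{t+1})-p^\star\le\frac{\hat\Gamma}t,\qquad\|M\bar x^{t+1}-\bar z^{t+1}\|\le\frac2t\sqrt{\frac{\hat\Gamma}\rho+d^2_{u^\star}}.$$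
   Context: Setting. $\mathcal X$ and $\mathcal Z=\mathcal H$ are finite-dimensional real inner-product spaces; $X\subset\mathcal X$, $Z\subset\mathcal Z$ are closed convex sets; $U\subset\mathcal H$ is a closed convex set; $M:\mathcal X\to\mathcal H$ is linear; $f$ is a smooth (Lipschitz gradient) convex function on $\mathcal X$. "psd" means symmetric positive semidefinite; $A\preceq B$ means $B-A$ is psd; $\|v\|_A^2=\langle v,Av\rangle$; $\|E\|$ is the spectral norm. Lagrangian: $L_\rho(x,z,u)=f(x)+g(z)+\langle\rho u,Mx-z\rangle$; $(x^\star,z^\star,u^\star)$ is a saddle point if $L_\rho(x^\star,z^\star,u)\le L_\rho(x^\star,z^\star,u^\star)\le L_\rho(x,z,u^\star)$ for all $x\in X,z\in Z,u\in U$. Relative smoothness: $f$ is $\hat L_f$-relatively smooth with respect to its Hessian $H_f$ if $\hat L_f>0$ and $f(x)\le f(y)+\langle\nabla f(y),x-y\rangle+\frac{\hat L_f}2\|x-y\|^2_{H_f(y)}$ for all $x,y\in X$. GeNI-ADMM with $f_1=0$, $f_2=f$, $\Psi^k=0$, $N=-I$: given $\tilde x^1\in X,\tilde z^1\in Z,\tilde u^1\in\mathcal H$ and non-negative forcing sequences, for $k=1,2,\dots$ choose: - $\tilde x^{k+1}\in X$ with $\|\tilde x^{k+1}-x^{k+1}_{\rm ex}\|\le\varepsilon_x^k$, where $x^{k+1}_{\rm ex}$ is the exact minimizer over $x\in X$ of $\langle\nabla f(\tilde x^k),x-\tilde x^k\rangle+\frac12\|x-\tilde x^k\|^2_{\Theta^k}+\frac\rho2\|Mx-\tilde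 z^k+\tilde u^k\|^2$; - $\tilde z^{k+1}\in Z$ whose objective value is within $\varepsilon_z^k$ of the minimum over $z\in Z$ of $g(z)+\frac\rho2\|M\tilde x^{k+1}-z+\tilde u^k\|^2$; - $\tilde u^{k+1}=\tilde u^k+M\tilde x^{k+1}-\tilde z^{k+1}$. *)

theory Defs
  imports "HOL-Analysis.Analysis"
begin

text \<open>Operators on a space are bounded linear maps \<^typ>\<open>'a \<Rightarrow>\<^sub>L 'a\<close>, so that \<^const>\<open>norm\<close> is the
  spectral (Euclidean operator) norm.\<close>

definition psd :: "('a::euclidean_space \<Rightarrow>\<^sub>L 'a) \<Rightarrow> bool" where
  "psd A \<longleftrightarrow>
     (\<forall>v w. inner (blinfun_apply A v) w = inner v (blinfun_apply A w)) \<and>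
     (\<forall>v. 0 \<le> inner v (blinfun_apply A v))"

definition loewner_le :: "('a::euclidean_space \<Rightarrow>\<^sub>L 'a) \<Rightarrow> ('a \<Rightarrow>\<^sub>L 'a) \<Rightarrow> bool"
    (infix "\<preceq>\<^sub>L" 50) where
  "A \<preceq>\<^sub>L B \<longleftrightarrow> psd (B - A)"

definition wnorm_sq :: "('a::euclidean_space \<Rightarrow>\<^sub>L 'a) \<Rightarrow> 'a \<Rightarrow> real" where
  "wnorm_sq A v = inner v (blinfun_apply A v)"

definition wnorm :: "('a::euclidean_space \<Rightarrow>\<^sub>L 'a) \<Rightarrow> 'a \<Rightarrow> real" where
  "wnorm A v = sqrt (wnorm_sq A v)"

text \<open>\<open>f\<close> is twice continuously differentiable with gradient \<open>gradf\<close> and Hessian \<open>Hf\<close>; both are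
  determined by \<open>f\<close>.\<close>

definition twice_cont_diff ::
  "('a::euclidean_space \<Rightarrow> real) \<Rightarrow> ('a \<Rightarrow> 'a) \<Rightarrow> ('a \<Rightarrow> 'a \<Rightarrow>\<^sub>L 'a) \<Rightarrow> bool" where
  "twice_cont_diff f gradf Hf \<longleftrightarrow>
     (\<forall>x. GDERIV f x :> gradf x) \<and>
     (\<forall>x. (gradf has_derivative blinfun_apply (Hf x)) (at x)) \<and>
     continuous_on UNIV Hf"

definition rel_smooth ::
  "'a::euclidean_space set \<Rightarrow> real \<Rightarrow> ('a \<Rightarrow> real) \<Rightarrow> ('a \<Rightarrow> 'a) \<Rightarrow> ('a \<Rightarrow> 'a \<Rightarrow>\<^sub>L 'a) \<Rightarrow> bool" where
  "rel_smooth X L f gradf Hf \<longleftrightarrow>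
     L > 0 \<and>
     (\<forall>x\<in>X. \<forall>y\<in>X.
        f x \<le> f y + inner (gradf y) (x - y) + L / 2 * wnorm_sq (Hf y) (x - y))"

definition lower_semicontinuous :: "('a::topological_space \<Rightarrow> real) \<Rightarrow> bool" where
  "lower_semicontinuous g \<longleftrightarrow> (\<forall>x. \<forall>c < g x. eventually (\<lambda>y. c < g y) (nhds x))"

definition feasible_set ::
  "'a set \<Rightarrow> 'b set \<Rightarrow> ('a::euclidean_space \<Rightarrow> 'b::euclidean_space) \<Rightarrow> ('a \<times> 'b) set" where
  "feasible_set X Z M = {(x, z). x \<in> X \<and> z \<in> Z \<and> M x - z = 0}"

definition optimal_value ::
  "'a set \<Rightarrow> 'b set \<Rightarrow> ('a::euclidean_space \<Rightarrow> 'b::euclidean_space) \<Rightarrow>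
   ('a \<Rightarrow> real) \<Rightarrow> ('b \<Rightarrow> real) \<Rightarrow> real" where
  "optimal_value X Z M f g = (INF (x, z) \<in> feasible_set X Z M. f x + g z)"

definition optimal_solution ::
  "'a set \<Rightarrow> 'b set \<Rightarrow> ('a::euclidean_space \<Rightarrow> 'b::euclidean_space) \<Rightarrow>
   ('a \<Rightarrow> real) \<Rightarrow> ('b \<Rightarrow> real) \<Rightarrow> 'a \<Rightarrow> 'b \<Rightarrow> bool" where
  "optimal_solution X Z M f g xs zs \<longleftrightarrow>
     is_arg_min (\<lambda>(x, z). f x + g z) (\<lambda>p. p \<in> feasible_set X Z M) (xs, zs)"

definition lagrangian ::
  "real \<Rightarrow> ('a::euclidean_space \<Rightarrow> 'b::euclidean_space) \<Rightarrow> ('a \<Rightarrow> real) \<Rightarrow> ('b \<Rightarrow> real) \<Rightarrow>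
   'a \<Rightarrow> 'b \<Rightarrow> 'b \<Rightarrow> real" where
  "lagrangian \<rho> M f g x z u = f x + g z + inner (\<rho> *\<^sub>R u) (M x - z)"

definition saddle_point ::
  "real \<Rightarrow> 'a set \<Rightarrow> 'b set \<Rightarrow> 'b set \<Rightarrow> ('a::euclidean_space \<Rightarrow> 'b::euclidean_space) \<Rightarrow>
   ('a \<Rightarrow> real) \<Rightarrow> ('b \<Rightarrow> real) \<Rightarrow> 'a \<Rightarrow> 'b \<Rightarrow> 'b \<Rightarrow> bool" where
  "saddle_point \<rho> X Z U M f g xs zs us \<longleftrightarrow>
     xs \<in> X \<and> zs \<in> Z \<and> us \<in> U \<and>
     (\<forall>x\<in>X. \<forall>z\<in>Z. \<forall>u\<in>U.
        lagrangian \<rho> M f g xs zs u \<le> lagrangian \<rho> M f g xs zs us \<and>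
        lagrangian \<rho> M f g xs zs us \<le> lagrangian \<rho> M f g x z us)"

definition x_objective ::
  "real \<Rightarrow> ('a::euclidean_space \<Rightarrow> 'b::euclidean_space) \<Rightarrow> ('a \<Rightarrow> 'a) \<Rightarrow> ('a \<Rightarrow>\<^sub>L 'a) \<Rightarrow>
   'a \<Rightarrow> 'b \<Rightarrow> 'b \<Rightarrow> 'a \<Rightarrow> real" where
  "x_objective \<rho> M gradf T xk zk uk x =
     inner (gradf xk) (x - xk) + 1 / 2 * wnorm_sq T (x - xk)
       + \<rho> / 2 * (norm (M x - zk + uk))\<^sup>2"

definition z_objective ::
  "real \<Rightarrow> ('a::euclidean_space \<Rightarrow> 'b::euclidean_space) \<Rightarrow> ('b \<Rightarrow> real) \<Rightarrow>
   'a \<Rightarrow> 'b \<Rightarrow> 'b \<Rightarrow> real" where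
  "z_objective \<rho> M g xk uk z = g z + \<rho> / 2 * (norm (M xk - z + uk))\<^sup>2"

text \<open>\<open>(x k, z k, u k)\<close>, \<open>k \<ge> 1\<close>, are iterates of GeNI-ADMM for \<open>f\<^sub>1 = 0\<close>, \<open>f\<^sub>2 = f\<close>, \<open>\<Psi>\<^sup>k = 0\<close>,
  \<open>N = -I\<close>. All sequences are indexed from 1; their values at 0 are irrelevant.\<close>

definition geni_admm_run ::
  "real \<Rightarrow> 'a set \<Rightarrow> 'b set \<Rightarrow> ('a::euclidean_space \<Rightarrow> 'b::euclidean_space) \<Rightarrow>
   ('a \<Rightarrow> 'a) \<Rightarrow> ('b \<Rightarrow> real) \<Rightarrow> (nat \<Rightarrow> 'a \<Rightarrow>\<^sub>L 'a) \<Rightarrow> (nat \<Rightarrow> real) \<Rightarrow> (nat \<Rightarrow> real) \<Rightarrow>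
   (nat \<Rightarrow> 'a) \<Rightarrow> (nat \<Rightarrow> 'b) \<Rightarrow> (nat \<Rightarrow> 'b) \<Rightarrow> bool" where
  "geni_admm_run \<rho> X Z M gradf g \<Theta> \<epsilon>x \<epsilon>z x z u \<longleftrightarrow>
     x 1 \<in> X \<and> z 1 \<in> Z \<and>
     (\<forall>k\<ge>1. 0 \<le> \<epsilon>x k \<and> 0 \<le> \<epsilon>z k) \<and>
     (\<forall>k\<ge>1.
        x (k + 1) \<in> X \<and>
        (\<exists>xe. is_arg_min (x_objective \<rho> M gradf (\<Theta> k) (x k) (z k) (u k)) (\<lambda>v. v \<in> X) xe \<and>
              norm (x (k + 1) - xe) \<le> \<epsilon>x k) \<and>
        z (k + 1) \<in> Z \<and>
        (\<exists>ze. is_arg_min (z_objective \<rho> M g (x (k + 1)) (u k)) (\<lambda>v. v \<in> Z) ze \<and>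
              z_objective \<rho> M g (x (k + 1)) (u k) (z (k + 1))
                \<le> z_objective \<rho> M g (x (k + 1)) (u k) ze + \<epsilon>z k) \<and>
        u (k + 1) = u k + M (x (k + 1)) - z (k + 1))"

text \<open>\<open>ergodic_avg v t\<close> is the average written with superscript \<open>t + 1\<close>.\<close>

definition ergodic_avg :: "(nat \<Rightarrow> 'a::real_vector) \<Rightarrow> nat \<Rightarrow> 'a" where
  "ergodic_avg v t = (1 / real t) *\<^sub>R (\<Sum>k=2..t+1. v k)"

end

theory Submission
  imports Defs
begin

text \<open>Relative smoothness together with \<open>\<Theta>\<^sup>k \<succeq> L H\<^sub>f(x\<^sup>k)\<close>, the variational inequality of the
  \<open>x\<close>-subproblem and the strong convexity of the \<open>z\<close>-subproblem give, for every multiplier \<open>v\<close>,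
  that the Lagrangian gap of the new iterate at \<open>v\<close> is at most the decrease of
  \<open>\<Phi>\<^sup>k(v) = 1/2 \<parallel>x\<^sup>k - x\<^sup>\<star>\<parallel>\<^sup>2 + \<rho>/2 \<parallel>z\<^sup>k - z\<^sup>\<star>\<parallel>\<^sup>2 + \<rho>/2 \<parallel>u\<^sup>k - v\<parallel>\<^sup>2\<close> (the first norm weighted by \<open>\<Theta>\<^sup>k\<close>),
  up to an error of order \<open>\<epsilon>\<^sub>x + \<surd>\<epsilon>\<^sub>z\<close> times the distance of the iterates from the saddle
  point. For \<open>v = u\<^sup>\<star>\<close> the gap is nonnegative, and a discrete Gronwall argument bounds the iterates,
  so all errors are summable. Telescoping with \<open>v = 0 = u\<^sup>1\<close> bounds the objective at the averages,
  and telescoping with \<open>v = u\<^sup>\<star>\<close> bounds \<open>\<parallel>u\<^sup>t\<^sup>+\<^sup>1 - u\<^sup>\<star>\<parallel>\<close>, hence the residual \<open>(u\<^sup>t\<^sup>+\<^sup>1 - u\<^sup>1) / t\<close>.\<close>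

section \<open>Quadratic expansions and weighted norms\<close>

text \<open>Dividing by \<open>s\<close> and letting \<open>s\<close> tend to 0 from the right
  removes the quadratic term. Both subproblems use this to turn minimality along a segment into a
  first-order condition, also when the objective contains the merely convex
  \<open>g\<close>.\<close>

lemma linear_coeff_nonneg:
  fixes a b :: real
  assumes "\<And>s. 0 < s \<Longrightarrow> s \<le> 1 \<Longrightarrow> 0 \<le> s * a + s\<^sup>2 * b"
  shows "0 \<le> a"
proof -
  have "((\<lambda>s. a + s * b) \<longlongrightarrow> a + 0 * b) (at_right 0)"
    by (intro tendsto_intros)
  moreover have "\<forall>\<^sub>F s in at_right 0. 0 \<le> a + s * b"
  proof (rule eventually_at_rightI[of 0 1])
    fix s :: real assume s: "s \<in> {0<..<1}"
    with assms[of s] have "0 \<le> s * (a + s * b)"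
      by (simp add: algebra_simps power2_eq_square)
    with s show "0 \<le> a + s * b" by (simp add: zero_le_mult_iff)
  qed simp
  ultimately show ?thesis
    using tendsto_lowerbound by fastforce
qed

lemma power2_norm_add_scaleR:
  fixes a b :: "'a::real_inner"
  shows "(norm (a + s *\<^sub>R b))\<^sup>2 = (norm a)\<^sup>2 + 2 * s * inner a b + s\<^sup>2 * (norm b)\<^sup>2"
  unfolding power2_norm_eq_inner
  by (simp add: inner_add_left inner_add_right inner_commute[of b a] power2_eq_square algebra_simps)

text \<open>This is the Cauchy-Schwarz argument: the form is nonnegative at the difference of
  \<open>v\<close> and \<open>w\<close> rescaled to equal length. The bound \<open>c\<close> then
  enters both squares alike, and the positive factor \<open>2 * a * b\<close> can be
  cancelled.\<close>

lemma psd_inner_le: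
  assumes "psd T" and "\<And>v. wnorm_sq T v \<le> c * (norm v)\<^sup>2"
  shows "inner (blinfun_apply T v) w \<le> c * norm v * norm w"
proof (cases "v = 0 \<or> w = 0")
  case False
  define a b where "a = norm v" and "b = norm w"
  have ab: "a > 0" "b > 0" using False by (auto simp: a_def b_def)
  have sym: "inner w (blinfun_apply T v) = inner (blinfun_apply T v) w"
    "inner v (blinfun_apply T w) = inner (blinfun_apply T v) w"
    using assms(1) by (auto simp: psd_def inner_commute)
  have "0 \<le> inner (b *\<^sub>R v - a *\<^sub>R w) (blinfun_apply T (b *\<^sub>R v - a *\<^sub>R w))"
    using assms(1) by (auto simp: psd_def)
  also have "\<dots> = b\<^sup>2 * wnorm_sq T v + a\<^sup>2 * wnorm_sq T w - 2 * a * b * inner (blinfun_apply T v) w"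
    by (simp add: blinfun.diff_right blinfun.scaleR_right inner_diff_left inner_diff_right sym
        wnorm_sq_def power2_eq_square algebra_simps)
  also have "\<dots> \<le> b\<^sup>2 * (c * a\<^sup>2) + a\<^sup>2 * (c * b\<^sup>2) - 2 * a * b * inner (blinfun_apply T v) w"
    using assms(2)[of v] assms(2)[of w]
    by (intro diff_right_mono add_mono mult_left_mono) (auto simp: a_def b_def)
  also have "\<dots> = 2 * a * b * (c * a * b - inner (blinfun_apply T v) w)"
    by (simp add: power2_eq_square algebra_simps)
  finally have "0 \<le> 2 * a * b * (c * a * b - inner (blinfun_apply T v) w)" .
  moreover have "0 < 2 * a * b" using ab by simp
  ultimately have "0 \<le> c * a * b - inner (blinfun_apply T v) w"
    using zero_le_mult_iff by (metis less_le_not_le)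
  then show ?thesis by (simp add: a_def b_def)
qed auto

lemma loewner_scaled_id_bounds:
  assumes "T \<preceq>\<^sub>L b *\<^sub>R id_blinfun" and "a *\<^sub>R id_blinfun \<preceq>\<^sub>L T" and "0 < a"
  shows "psd T" and "wnorm_sq T v \<le> b * (norm v)\<^sup>2" and "a * (norm v)\<^sup>2 \<le> wnorm_sq T v"
proof -
  show up: "wnorm_sq T v \<le> b * (norm v)\<^sup>2" and lo: "a * (norm v)\<^sup>2 \<le> wnorm_sq T v" for v
    using assms(1,2)
    by (auto simp: loewner_le_def psd_def wnorm_sq_def blinfun.diff_left blinfun.scaleR_left
        inner_diff_right power2_norm_eq_inner)
  have "0 \<le> wnorm_sq T v" for v
    by (rule order_trans[OF _ lo]) (use assms(3) in simp)
  \<comment> \<open>Symmetry of \<open>T\<close> is inherited from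
    \<open>T - a *\<^sub>R id_blinfun\<close>, because multiples of the identity are
    symmetric.\<close>
  then show "psd T"
    using assms(2)
    by (auto simp: loewner_le_def psd_def wnorm_sq_def blinfun.diff_left blinfun.scaleR_left
        inner_diff_right inner_diff_left)
qed

lemma abs_wnorm_sq_diff_le:
  "\<bar>wnorm_sq A v - wnorm_sq B v\<bar> \<le> norm (A - B) * (norm v)\<^sup>2"
proof -
  have "\<bar>wnorm_sq A v - wnorm_sq B v\<bar> = \<bar>inner v (blinfun_apply (A - B) v)\<bar>"
    by (simp add: wnorm_sq_def blinfun.diff_left inner_diff_right)
  also have "\<dots> \<le> norm v * norm (blinfun_apply (A - B) v)"
    by (rule Cauchy_Schwarz_ineq2)
  also have "\<dots> \<le> norm v * (norm (A - B) * norm v)"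
    by (intro mult_left_mono norm_blinfun) auto
  finally show ?thesis by (simp add: power2_eq_square mult_ac)
qed

section \<open>First-order optimality of the two subproblems\<close>

text \<open>Along the segment from \<open>xe\<close> to \<open>w\<close>, which stays in
  \<open>X\<close> by convexity, the objective is a quadratic polynomial in \<open>s\<close> whose
  linear coefficient is the right-hand side. Symmetry of \<open>T\<close> merges the two cross
  terms.\<close>

lemma x_objective_variational_inequality:
  fixes M :: "'a::euclidean_space \<Rightarrow> 'b::euclidean_space"
  assumes M: "linear M" and "convex X" and "psd T"
    and min: "is_arg_min (x_objective \<rho> M gradf T x z u) (\<lambda>v. v \<in> X) xe"
    and "w \<in> X"
  shows "0 \<le> inner (gradf x) (w - xe) + inner (blinfun_apply T (xe - x)) (w - xe)
               + \<rho> * inner (M xe - z + u) (M (w - xe))"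
proof (rule linear_coeff_nonneg)
  fix s :: real assume s: "0 < s" "s \<le> 1"
  let ?d = "w - xe"
  have "xe \<in> X" using min by (simp add: is_arg_min_def)
  moreover have "(1 - s) *\<^sub>R xe + s *\<^sub>R w = xe + s *\<^sub>R ?d" by (simp add: algebra_simps)
  ultimately have "xe + s *\<^sub>R ?d \<in> X"
    using convexD_alt[OF assms(2), of xe w s] s assms(5) by simp
  then have "x_objective \<rho> M gradf T x z u xe \<le> x_objective \<rho> M gradf T x z u (xe + s *\<^sub>R ?d)"
    using min by (simp add: is_arg_min_linorder)
  moreover have wT: "wnorm_sq T (xe + s *\<^sub>R ?d - x) = wnorm_sq T (xe - x)
      + 2 * s * inner (blinfun_apply T (xe - x)) ?d + s\<^sup>2 * wnorm_sq T ?d"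
  proof -
    have "inner ?d (blinfun_apply T (xe - x)) = inner (blinfun_apply T (xe - x)) ?d"
      "inner (xe - x) (blinfun_apply T ?d) = inner (blinfun_apply T (xe - x)) ?d"
      using assms(3) by (simp_all add: psd_def inner_commute)
    moreover have "xe + s *\<^sub>R ?d - x = (xe - x) + s *\<^sub>R ?d" by simp
    ultimately show ?thesis
      by (simp only: wnorm_sq_def blinfun.add_right blinfun.scaleR_right inner_add_left
          inner_add_right inner_scaleR_left inner_scaleR_right)
        (simp add: power2_eq_square distrib_left)
  qed
  moreover have nM: "(norm (M (xe + s *\<^sub>R ?d) - z + u))\<^sup>2 = (norm (M xe - z + u))\<^sup>2
      + 2 * s * inner (M xe - z + u) (M ?d) + s\<^sup>2 * (norm (M ?d))\<^sup>2"
  proof -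
    have "M (xe + s *\<^sub>R ?d) - z + u = (M xe - z + u) + s *\<^sub>R M ?d"
      by (simp only: linear_add[OF M] linear_scale[OF M]) simp
    then show ?thesis
      by (simp only: power2_norm_add_scaleR)
  qed
  moreover have gx: "inner (gradf x) (xe + s *\<^sub>R ?d - x)
      = inner (gradf x) (xe - x) + s * inner (gradf x) ?d"
    by (simp add: inner_add_right inner_diff_right)
  ultimately show "0 \<le> s * (inner (gradf x) ?d + inner (blinfun_apply T (xe - x)) ?d
      + \<rho> * inner (M xe - z + u) (M ?d))
      + s\<^sup>2 * (1 / 2 * wnorm_sq T ?d + \<rho> / 2 * (norm (M ?d))\<^sup>2)"
    unfolding x_objective_def wT nM gx by (simp add: ring_distribs mult_ac)
qed

text \<open>Minimality along the segment and convexity of \<open>g\<close> give the subgradient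
  inequality \<open>\<rho> * inner ?r ?d \<le> g w - g ze\<close>. The penalty is expanded exactly,
  and its second-order term is the growth.\<close>

lemma z_objective_growth:
  fixes M :: "'a::euclidean_space \<Rightarrow> 'b::euclidean_space"
  assumes "convex_on UNIV g" and "convex Z"
    and min: "is_arg_min (z_objective \<rho> M g x u) (\<lambda>v. v \<in> Z) ze" and "w \<in> Z"
  shows "z_objective \<rho> M g x u ze + \<rho> / 2 * (norm (w - ze))\<^sup>2 \<le> z_objective \<rho> M g x u w"
proof -
  let ?d = "w - ze" and ?r = "M x - ze + u"
  have expand: "(norm (M x - (ze + s *\<^sub>R ?d) + u))\<^sup>2
      = (norm ?r)\<^sup>2 - 2 * s * inner ?r ?d + s\<^sup>2 * (norm ?d)\<^sup>2" for s
  proof -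
    have "M x - (ze + s *\<^sub>R ?d) + u = ?r + (- s) *\<^sub>R ?d" by simp
    then show ?thesis
      by (simp only: power2_norm_add_scaleR) simp
  qed
  have "0 \<le> g w - g ze - \<rho> * inner ?r ?d"
  proof (rule linear_coeff_nonneg)
    fix s :: real assume s: "0 < s" "s \<le> 1"
    have "ze \<in> Z" using min by (simp add: is_arg_min_def)
    moreover have eq: "(1 - s) *\<^sub>R ze + s *\<^sub>R w = ze + s *\<^sub>R ?d" by (simp add: algebra_simps)
    ultimately have "ze + s *\<^sub>R ?d \<in> Z"
      using convexD_alt[OF assms(2), of ze w s] s assms(4) by simp
    then have "z_objective \<rho> M g x u ze \<le> z_objective \<rho> M g x u (ze + s *\<^sub>R ?d)"
      using min by (simp add: is_arg_min_linorder)
    moreover have "g (ze + s *\<^sub>R ?d) \<le> (1 - s) * g ze + s * g w"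
      using convex_onD[OF assms(1), of s ze w] s eq by simp
    ultimately show "0 \<le> s * (g w - g ze - \<rho> * inner ?r ?d) + s\<^sup>2 * (\<rho> / 2 * (norm ?d)\<^sup>2)"
      unfolding z_objective_def expand by (simp add: algebra_simps)
  qed
  moreover have nw: "(norm (M x - w + u))\<^sup>2 = (norm ?r)\<^sup>2 - 2 * inner ?r ?d + (norm ?d)\<^sup>2"
    using expand[of 1] by simp
  ultimately show ?thesis
    unfolding z_objective_def nw by (simp add: ring_distribs mult_ac)
qed

lemma wnorm_sq_diff:
  assumes "psd T"
  shows "wnorm_sq T (v - w) = wnorm_sq T v - 2 * inner (blinfun_apply T w) v + wnorm_sq T w"
proof -
  have "inner v (blinfun_apply T w) = inner (blinfun_apply T w) v"
    "inner w (blinfun_apply T v) = inner (blinfun_apply T w) v"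
    using assms by (simp_all add: psd_def inner_commute)
  then show ?thesis
    by (simp add: wnorm_sq_def blinfun.diff_right inner_diff_left inner_diff_right)
qed

section \<open>One-step inequalities for inexact subproblem solutions\<close>

text \<open>The square of \<open>x' - x\<close> in the smoothness bound cancels exactly against the
  one from the three-point identity for \<open>x\<close>, \<open>x'\<close>, \<open>xs\<close>. The
  variational inequality holds at \<open>xe\<close> only; passing to \<open>x'\<close> costs the
  bracketed terms, each of which contains the factor \<open>x' - xe\<close>.\<close>

lemma x_step_inequality:
  fixes M :: "'a::euclidean_space \<Rightarrow> 'b::euclidean_space"
  assumes M: "linear M" and "convex X" and T: "psd T"
    and "is_arg_min (x_objective \<rho> M gradf T x z u) (\<lambda>v. v \<in> X) xe" and "xs \<in> X"
    and smooth: "f x' \<le> f x + inner (gradf x) (x' - x) + 1 / 2 * wnorm_sq T (x' - x)"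
    and grad: "f x + inner (gradf x) (xs - x) \<le> f xs"
  shows "f x' - f xs \<le> 1 / 2 * wnorm_sq T (x - xs) - 1 / 2 * wnorm_sq T (x' - xs)
           - \<rho> * inner (M x' - z + u) (M (x' - xs))
           + (inner (gradf x) (x' - xe) + inner (blinfun_apply T (xe - x)) (x' - xe)
              + \<rho> * inner (M xe - z + u) (M (x' - xe))
              + inner (blinfun_apply T (x' - xe)) (x' - xs)
              + \<rho> * inner (M (x' - xe)) (M (x' - xs)))"
proof -
  define d e where "d = x' - xe" and "e = x' - xs"
  \<comment> \<open>Since \<open>d - e = xs - xe\<close>, this is the variational inequality tested
    at \<open>xs\<close>.\<close>
  have "0 \<le> inner (gradf x) (d - e) + inner (blinfun_apply T (xe - x)) (d - e)
               + \<rho> * inner (M xe - z + u) (M (d - e))"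
    using x_objective_variational_inequality[OF assms(1-5)] by (simp add: d_def e_def)
  then have vi: "inner (gradf x) e \<le> inner (gradf x) d
      + (inner (blinfun_apply T (xe - x)) d - inner (blinfun_apply T (xe - x)) e)
      + \<rho> * (inner (M xe - z + u) (M d) - inner (M xe - z + u) (M e))"
    by (simp only: linear_diff[OF M] inner_diff_right)
  have "xs - x = (x' - x) - e" by (simp add: e_def)
  then have "inner (gradf x) (xs - x) = inner (gradf x) (x' - x) - inner (gradf x) e"
    by (simp only: inner_diff_right)
  then have fe: "f x' - f xs \<le> inner (gradf x) e + 1 / 2 * wnorm_sq T (x' - x)"
    using smooth grad by linarith
  have "x' - x = (xe - x) + d" by (simp add: d_def)
  then have Te: "inner (blinfun_apply T (x' - x)) e
      = inner (blinfun_apply T (xe - x)) e + inner (blinfun_apply T d) e"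
    by (simp only: blinfun.add_right inner_add_left)
  have "x - xs = e - (x' - x)" by (simp add: e_def)
  then have w: "wnorm_sq T (x - xs) = wnorm_sq T e - 2 * inner (blinfun_apply T (x' - x)) e
      + wnorm_sq T (x' - x)"
    by (simp only: wnorm_sq_diff[OF T])
  have "M x' - z + u = (M xe - z + u) + M d" by (simp add: d_def linear_diff[OF M])
  then have r: "inner (M x' - z + u) (M e) = inner (M xe - z + u) (M e) + inner (M d) (M e)"
    by (simp only: inner_add_left)
  show ?thesis
    unfolding d_def[symmetric] e_def[symmetric] r w Te using vi fe by (simp add: ring_distribs Te)
qed

text \<open>Quadratic growth is used twice. At \<open>z'\<close> it converts the objective error
  \<epsilon> into a distance to \<open>ze\<close> of order \<open>sqrt \<epsilon>\<close>, which is
  why square roots of the forcing terms have to be summable. At \<open>zs\<close> it gives the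
  estimate itself, where the squares of \<open>z' - zs\<close> cancel.\<close>

lemma z_step_inequality:
  fixes M :: "'a::euclidean_space \<Rightarrow> 'b::euclidean_space"
  assumes "convex_on UNIV g" and "convex Z" and "0 < \<rho>"
    and min: "is_arg_min (z_objective \<rho> M g x' u) (\<lambda>v. v \<in> Z) ze"
    and z': "z' \<in> Z" and zs: "zs \<in> Z"
    and approx: "z_objective \<rho> M g x' u z' \<le> z_objective \<rho> M g x' u ze + \<epsilon>"
  shows "g z' - g zs \<le> \<rho> * inner (u + M x' - z') (z' - zs)
           + (sqrt (2 * \<rho> * \<epsilon>) * norm (z' - zs) + \<epsilon>)"
proof -
  note growth = z_objective_growth[OF assms(1,2) min]
  define d p q where "d = z' - ze" and "p = z' - zs" and "q = M x' - z' + u"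
  have "\<rho> / 2 * (norm d)\<^sup>2 \<le> \<epsilon>" using growth[OF z'] approx by (simp add: d_def)
  then have "(\<rho> * norm d)\<^sup>2 \<le> 2 * \<rho> * \<epsilon>"
    using assms(3) by (simp add: power2_eq_square field_simps)
  then have d: "\<rho> * norm d \<le> sqrt (2 * \<rho> * \<epsilon>)"
    using real_le_rsqrt by blast
  have "\<rho> * inner p d \<le> (\<rho> * norm d) * norm p"
    using norm_cauchy_schwarz[of p d] assms(3) by (simp add: mult.assoc mult.commute)
  also have "\<dots> \<le> sqrt (2 * \<rho> * \<epsilon>) * norm p" by (intro mult_right_mono d) auto
  finally have pd: "\<rho> * inner p d \<le> sqrt (2 * \<rho> * \<epsilon>) * norm p" .
  have main: "z_objective \<rho> M g x' u z' + \<rho> / 2 * (norm (zs - ze))\<^sup>2 - \<epsilon>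
      \<le> z_objective \<rho> M g x' u zs"
    using growth[OF zs] approx by linarith
  have "M x' - zs + u = q + 1 *\<^sub>R p" by (simp add: q_def p_def)
  then have n1: "(norm (M x' - zs + u))\<^sup>2 = (norm q)\<^sup>2 + 2 * inner q p + (norm p)\<^sup>2"
    by (simp only: power2_norm_add_scaleR) simp
  have "ze - zs = p + (- 1) *\<^sub>R d" by (simp add: d_def p_def)
  then have n2: "(norm (zs - ze))\<^sup>2 = (norm p)\<^sup>2 - 2 * inner p d + (norm d)\<^sup>2"
    by (subst norm_minus_commute) (simp only: power2_norm_add_scaleR, simp)
  have "u + M x' - z' = q" by (simp add: q_def)
  moreover have "0 \<le> \<rho> * (norm d)\<^sup>2" using assms(3) by simp
  ultimately show ?thesis
    using main pd unfolding z_objective_def n1 n2 q_def[symmetric] p_def[symmetric]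
    by (simp add: ring_distribs mult_ac)
qed

text \<open>The leftover terms of the two telescoping differences form the square
  \<open>\<parallel>(z' - z) + (u' - u)\<parallel>\<^sup>2\<close>; its sign spares the use of the optimality of the previous \<open>z\<close>.\<close>

lemma admm_multiplier_inequality:
  fixes z z' zs u u' v r :: "'b::real_inner"
  assumes "0 \<le> \<rho>" and u': "u' = u + r"
  shows "- \<rho> * inner (u' + z' - z) (r + (z' - zs)) + \<rho> * inner u' (z' - zs) + \<rho> * inner v r
    \<le> \<rho> / 2 * ((norm (z - zs))\<^sup>2 - (norm (z' - zs))\<^sup>2)
      + \<rho> / 2 * ((norm (u - v))\<^sup>2 - (norm (u' - v))\<^sup>2)"
proof -
  define a b p where "a = z' - z" and "b = u' - v" and "p = z' - zs"
  have "z - zs = p + (- 1) *\<^sub>R a" "u - v = b + (- 1) *\<^sub>R r"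
    by (simp_all add: a_def b_def p_def u')
  then have n: "(norm (z - zs))\<^sup>2 = (norm p)\<^sup>2 - 2 * inner p a + (norm a)\<^sup>2"
    "(norm (u - v))\<^sup>2 = (norm b)\<^sup>2 - 2 * inner b r + (norm r)\<^sup>2"
    by (simp_all only: power2_norm_add_scaleR) simp_all
  have "0 \<le> \<rho> / 2 * (norm (a + 1 *\<^sub>R r))\<^sup>2" using assms(1) by simp
  then have sq: "0 \<le> \<rho> / 2 * ((norm a)\<^sup>2 + 2 * inner a r + (norm r)\<^sup>2)"
    by (simp only: power2_norm_add_scaleR) simp
  have "u' + z' - z = (b + v) + a" "u' = b + v" by (simp_all add: a_def b_def)
  then have i: "inner (u' + z' - z) (r + p) = inner b r + inner v r + inner a r
      + (inner b p + inner v p + inner p a)" "inner u' p = inner b p + inner v p"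
    by (simp_all only: inner_add_left inner_add_right inner_commute[of a p])
  show ?thesis
    unfolding n b_def[symmetric] p_def[symmetric] i using sq by (simp add: ring_distribs)
qed

text \<open>Each of the five terms pairs a factor growing at most linearly in the distances to the
  saddle point with one of order \<epsilon>. The summand 1 in \<open>N\<close> absorbs constants,
  and the cap \<open>B\<close> on \<epsilon> keeps the coefficient the same for all
  iterations.\<close>

lemma x_step_error_bound:
  fixes M :: "'a::euclidean_space \<Rightarrow> 'b::euclidean_space" and x :: 'a and z u us :: 'b
  assumes M: "linear M" and m: "\<And>v. norm (M v) \<le> m * norm v" "0 \<le> m"
    and T: "psd T" "\<And>v. wnorm_sq T v \<le> \<theta> * (norm v)\<^sup>2" "0 \<le> \<theta>"
    and lip: "L-lipschitz_on UNIV gradf" and "0 \<le> \<rho>"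
    and \<epsilon>: "norm (x' - xe) \<le> \<epsilon>" "\<epsilon> \<le> B" and zs: "M xs = zs"
  defines "N \<equiv> 1 + norm (x - xs) + norm (z - zs) + norm (u - us) + norm (x' - xs)"
  shows "inner (gradf x) (x' - xe) + inner (blinfun_apply T (xe - x)) (x' - xe)
              + \<rho> * inner (M xe - z + u) (M (x' - xe))
              + inner (blinfun_apply T (x' - xe)) (x' - xs)
              + \<rho> * inner (M (x' - xe)) (M (x' - xs))
      \<le> ((norm (gradf xs) + L) + \<theta> * (B + 1) + \<rho> * m * (m * B + m + 1 + norm us) + \<theta> + \<rho> * m * m)
         * N * \<epsilon>"
proof -
  have \<epsilon>0: "0 \<le> \<epsilon>" using \<epsilon>(1) norm_ge_zero order_trans by blast
  have B0: "0 \<le> B" using \<epsilon>0 \<epsilon>(2) by simp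
  have L0: "0 \<le> L" using lip by (rule lipschitz_on_nonneg)
  have N: "1 \<le> N" "norm (x - xs) + norm (x' - xs) \<le> N" "norm (x - xs) \<le> N" "norm (x' - xs) \<le> N"
    "norm (z - zs) + norm (u - us) \<le> N"
    by (simp_all add: N_def)
  have scale: "c \<le> c * N" if "0 \<le> c" for c using N(1) that by (simp add: mult_le_cancel_left1)
  have 1: "inner (gradf x) (x' - xe) \<le> (norm (gradf xs) + L) * N * \<epsilon>"
  proof -
    have "norm (gradf x - gradf xs) \<le> L * norm (x - xs)"
      using lipschitz_onD[OF lip, of x xs] by (simp add: dist_norm)
    then have "norm (gradf x) \<le> norm (gradf xs) + L * norm (x - xs)"
      using norm_triangle_sub[of "gradf x" "gradf xs"] by linarith
    also have "\<dots> \<le> norm (gradf xs) * N + L * N"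
      using scale[of "norm (gradf xs)"] mult_left_mono[OF N(3) L0] by simp
    finally have "norm (gradf x) \<le> (norm (gradf xs) + L) * N" by (simp add: ring_distribs)
    then have "norm (gradf x) * norm (x' - xe) \<le> (norm (gradf xs) + L) * N * \<epsilon>"
      using \<epsilon>(1) L0 N(1) by (intro mult_mono) auto
    then show ?thesis using norm_cauchy_schwarz[of "gradf x" "x' - xe"] by linarith
  qed
  have 2: "inner (blinfun_apply T (xe - x)) (x' - xe) \<le> \<theta> * (B + 1) * N * \<epsilon>"
  proof -
    have "norm (xe - x) \<le> norm (x' - xe) + (norm (x - xs) + norm (x' - xs))"
      using norm_triangle_ineq4[of "x' - xs" "x - xs"] norm_triangle_ineq4[of "x' - x" "x' - xe"]
      by simp
    also have "\<dots> \<le> B * N + N" using \<epsilon> N(2) scale[OF B0] by linarith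
    finally have "\<theta> * norm (xe - x) \<le> \<theta> * (B + 1) * N"
      using T(3) by (simp add: mult_left_mono ring_distribs mult.assoc flip: distrib_left)
    then have "\<theta> * norm (xe - x) * norm (x' - xe) \<le> \<theta> * (B + 1) * N * \<epsilon>"
      using \<epsilon>(1) T(3) B0 N(1) by (intro mult_mono[of "\<theta> * norm (xe - x)"]) auto
    then show ?thesis using psd_inner_le[OF T(1,2), of "xe - x" "x' - xe"] by linarith
  qed
  have Md: "norm (M (x' - xe)) \<le> m * \<epsilon>"
    using m(1)[of "x' - xe"] mult_left_mono[OF \<epsilon>(1) m(2)] by linarith
  have 3: "\<rho> * inner (M xe - z + u) (M (x' - xe)) \<le> \<rho> * m * (m * B + m + 1 + norm us) * N * \<epsilon>"
  proof -
    \<comment> \<open>Feasibility \<open>M xs = zs\<close> lets the residual be centred at the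
      saddle point; only the constant \<open>us\<close> is left over.\<close>
    have "M xe - z + u = (M (x' - xs) - M (x' - xe)) + (((u - us) - (z - zs)) + us)"
      by (simp add: linear_diff[OF M] zs)
    then have "norm (M xe - z + u) \<le> norm (M (x' - xs)) + norm (M (x' - xe))
        + ((norm (u - us) + norm (z - zs)) + norm us)"
      by (simp only: norm_triangle_mono norm_triangle_ineq4 order_refl)
    also have "\<dots> \<le> m * N + m * B * N + (N + norm us * N)"
    proof -
      have "norm (M (x' - xs)) \<le> m * N"
        using m(1)[of "x' - xs"] mult_left_mono[OF N(4) m(2)] by linarith
      moreover have "norm (M (x' - xe)) \<le> m * B * N"
        using Md mult_left_mono[OF \<epsilon>(2) m(2)] scale[of "m * B"] m(2) B0 by simp
      ultimately show ?thesis using N(5) scale[of "norm us"] by simp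
    qed
    finally have "norm (M xe - z + u) \<le> (m * B + m + 1 + norm us) * N"
      by (simp add: ring_distribs)
    then have "norm (M xe - z + u) * norm (M (x' - xe)) \<le> (m * B + m + 1 + norm us) * N * (m * \<epsilon>)"
      using Md m(2) B0 N(1) by (intro mult_mono) auto
    then have "inner (M xe - z + u) (M (x' - xe)) \<le> (m * B + m + 1 + norm us) * N * (m * \<epsilon>)"
      using norm_cauchy_schwarz order_trans by blast
    from mult_left_mono[OF this \<open>0 \<le> \<rho>\<close>] show ?thesis by (simp add: mult_ac)
  qed
  have 4: "inner (blinfun_apply T (x' - xe)) (x' - xs) \<le> \<theta> * N * \<epsilon>"
  proof -
    have "norm (x' - xe) * norm (x' - xs) \<le> \<epsilon> * N"
      using \<epsilon>(1) N(4) \<epsilon>0 by (intro mult_mono) auto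
    from mult_left_mono[OF this T(3)] show ?thesis
      using psd_inner_le[OF T(1,2), of "x' - xe" "x' - xs"] by (simp add: mult_ac)
  qed
  have 5: "\<rho> * inner (M (x' - xe)) (M (x' - xs)) \<le> \<rho> * m * m * N * \<epsilon>"
  proof -
    have "norm (M (x' - xs)) \<le> m * N"
      using m(1)[of "x' - xs"] mult_left_mono[OF N(4) m(2)] by linarith
    then have "norm (M (x' - xe)) * norm (M (x' - xs)) \<le> (m * \<epsilon>) * (m * N)"
      using Md m(2) \<epsilon>0 by (intro mult_mono) auto
    then have "inner (M (x' - xe)) (M (x' - xs)) \<le> (m * \<epsilon>) * (m * N)"
      using norm_cauchy_schwarz order_trans by blast
    from mult_left_mono[OF this \<open>0 \<le> \<rho>\<close>] show ?thesis by (simp add: mult_ac)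
  qed
  show ?thesis using 1 2 3 4 5 by (simp only: distrib_right)
qed

section \<open>A discrete Gronwall bound\<close>

text \<open>Here \<open>P k\<close> is the potential after step \<open>k\<close> in the old weight
  and \<open>W (Suc k)\<close> the one in the new weight. The error involves both ends of the step,
  so \<open>P k\<close> is first absorbed on the left, which is possible once
  \<open>\<delta> k < 1/2\<close>. The resulting growth factors have a bounded product, by
  comparison with the exponential of a convergent sum.\<close>

lemma perturbed_recursion_bounded:
  fixes W P \<delta> \<zeta> :: "nat \<Rightarrow> real"
  assumes "\<And>k. 0 \<le> W k" and "\<And>k. 0 \<le> P k" and \<delta>: "\<And>k. 0 \<le> \<delta> k" and \<zeta>: "\<And>k. 0 \<le> \<zeta> k"
    and "summable \<delta>" and "summable \<zeta>"
    and W_step: "\<And>k. W (Suc k) \<le> (1 + \<zeta> k) * P k"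
    and P_le: "\<And>k. P k \<le> W k + \<delta> k * (W k + P k)"
  shows "\<exists>B. \<forall>k. W k \<le> B"
proof -
  have "\<delta> \<longlonglongrightarrow> 0" by (rule summable_LIMSEQ_zero) fact
  then have "\<forall>\<^sub>F k in sequentially. \<delta> k < 1/2" by (rule order_tendstoD) simp
  then obtain K where K: "\<And>k. k \<ge> K \<Longrightarrow> \<delta> k < 1/2" by (auto simp: eventually_sequentially)
  have step: "W (Suc k) \<le> (1 + \<zeta> k) * (1 + 4 * \<delta> k) * W k" if "k \<ge> K" for k
  proof -
    have "(1 - \<delta> k) * P k \<le> (1 + \<delta> k) * W k" using P_le[of k] by (simp add: algebra_simps)
    also have "\<dots> \<le> (1 - \<delta> k) * (1 + 4 * \<delta> k) * W k"
    proof (rule mult_right_mono)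
      \<comment> \<open>This product is the difference of the two sides of the claim below; the
        coefficient 4 makes it nonnegative for all \<open>\<delta> k \<le> 1/2\<close>.\<close>
      have "0 \<le> 2 * \<delta> k * (1 - 2 * \<delta> k)" using \<delta>[of k] K[OF that] by simp
      then show "1 + \<delta> k \<le> (1 - \<delta> k) * (1 + 4 * \<delta> k)" by (simp add: algebra_simps)
    qed fact
    finally have "P k \<le> (1 + 4 * \<delta> k) * W k" using K[OF that] by (simp add: mult.assoc)
    then have "(1 + \<zeta> k) * P k \<le> (1 + \<zeta> k) * ((1 + 4 * \<delta> k) * W k)"
      using \<zeta>[of k] by (intro mult_left_mono) auto
    with W_step[of k] show ?thesis by (simp add: mult.assoc)
  qed
  have "W (K + n) \<le> exp (\<Sum>i<n. \<zeta> (K + i) + 4 * \<delta> (K + i)) * W K" for n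
  proof (induction n)
    case (Suc n)
    let ?k = "K + n"
    have "(1 + \<zeta> ?k) * (1 + 4 * \<delta> ?k) \<le> exp (\<zeta> ?k) * exp (4 * \<delta> ?k)"
      using \<zeta>[of ?k] \<delta>[of ?k] by (intro mult_mono exp_ge_add_one_self) auto
    then have "W (Suc ?k) \<le> exp (\<zeta> ?k + 4 * \<delta> ?k) * W ?k"
      using step[of ?k] mult_right_mono[OF _ assms(1)[of ?k]] unfolding exp_add
      by (meson le_add1 order_trans)
    also have "\<dots> \<le> exp (\<zeta> ?k + 4 * \<delta> ?k) * (exp (\<Sum>i<n. \<zeta> (K + i) + 4 * \<delta> (K + i)) * W K)"
      by (intro mult_left_mono Suc.IH) auto
    finally show ?case by (simp add: exp_add mult_ac)
  qed simp
  moreover have "(\<Sum>i<n. \<zeta> (K + i) + 4 * \<delta> (K + i)) \<le> (\<Sum>i. \<zeta> (i + K) + 4 * \<delta> (i + K))" for n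
  proof -
    have "summable (\<lambda>i. \<zeta> (i + K) + 4 * \<delta> (i + K))"
      using assms(5,6) by (intro summable_add summable_mult summable_ignore_initial_segment)
    then have "(\<Sum>i<n. \<zeta> (i + K) + 4 * \<delta> (i + K)) \<le> (\<Sum>i. \<zeta> (i + K) + 4 * \<delta> (i + K))"
      using \<delta> \<zeta> by (intro sum_le_suminf) (auto intro: add_nonneg_nonneg)
    then show ?thesis by (simp add: add.commute)
  qed
  ultimately have tail: "W (K + n) \<le> exp (\<Sum>i. \<zeta> (i + K) + 4 * \<delta> (i + K)) * W K" for n
    by (meson assms(1) exp_le_cancel_iff mult_right_mono order_trans)
  \<comment> \<open>The maximum covers the finitely many indices before the growth estimate sets
    in.\<close>
  have "W k \<le> Max (W ` {..K}) + exp (\<Sum>i. \<zeta> (i + K) + 4 * \<delta> (i + K)) * W K" for k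
  proof (cases "k \<le> K")
    case True
    then have "W k \<le> Max (W ` {..K})" by (intro Max_ge) auto
    then show ?thesis using assms(1)[of K] by (simp add: add_increasing2)
  next
    case False
    have "W K \<le> Max (W ` {..K})" by (intro Max_ge) auto
    moreover have "W k \<le> exp (\<Sum>i. \<zeta> (i + K) + 4 * \<delta> (i + K)) * W K"
      using False tail[of "k - K"] by simp
    ultimately show ?thesis using assms(1)[of K] by linarith
  qed
  then show ?thesis by blast
qed

section \<open>Averages and the gradient inequality\<close>

lemma ergodic_avg_eq: "ergodic_avg v t = (1 / real t) *\<^sub>R (\<Sum>k<t. v (k + 2))"
proof -
  have "(\<Sum>k=2..t+1. v k) = (\<Sum>k<t. v (k + 2))" by (induction t) auto
  then show ?thesis by (simp add: ergodic_avg_def)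
qed

lemma convex_on_ergodic_avg:
  assumes "convex_on UNIV h" and "1 \<le> t"
  shows "h (ergodic_avg v t) \<le> 1 / real t * (\<Sum>k<t. h (v (k + 2)))"
proof -
  have "h (\<Sum>k<t. (1 / real t) *\<^sub>R v (k + 2)) \<le> (\<Sum>k<t. 1 / real t * h (v (k + 2)))"
    using assms by (intro convex_on_sum) (auto simp: lessThan_empty_iff)
  then show ?thesis by (simp only: ergodic_avg_eq scaleR_sum_right sum_distrib_left)
qed

text \<open>Restriction to the line through \<open>x\<close> and \<open>y\<close> reduces this to
  the tangent inequality of a convex function of one real variable, between the parameters 0 and
  1.\<close>

lemma convex_on_gradient_inequality:
  fixes f :: "'a::real_inner \<Rightarrow> real"
  assumes "convex_on UNIV f" and "GDERIV f x :> d"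
  shows "f x + inner d (y - x) \<le> f y"
proof -
  let ?h = "\<lambda>s. f (x + s *\<^sub>R (y - x))"
  have "convex_on UNIV ?h"
  proof (rule convex_onI)
    fix t a b :: real assume "0 < t" "t < 1"
    moreover have "x + ((1 - t) *\<^sub>R a + t *\<^sub>R b) *\<^sub>R (y - x)
        = (1 - t) *\<^sub>R (x + a *\<^sub>R (y - x)) + t *\<^sub>R (x + b *\<^sub>R (y - x))"
      by (simp add: algebra_simps)
    ultimately show "?h ((1 - t) *\<^sub>R a + t *\<^sub>R b) \<le> (1 - t) * ?h a + t * ?h b"
      using convex_onD[OF assms(1), of t "x + a *\<^sub>R (y - x)" "x + b *\<^sub>R (y - x)"] by simp
  qed simp
  moreover have "(?h has_field_derivative inner d (y - x)) (at 0)"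
  proof -
    have "(f has_derivative (\<lambda>h. inner h d)) (at (x + 0 *\<^sub>R (y - x)))"
      using assms(2) by (simp add: gderiv_def)
    moreover have "((\<lambda>s. x + s *\<^sub>R (y - x)) has_derivative (\<lambda>s. s *\<^sub>R (y - x))) (at 0)"
      using has_derivative_add[OF has_derivative_const[of x]
          has_derivative_scaleR_left[OF has_derivative_ident]] by simp
    ultimately have "(?h has_derivative (\<lambda>s. inner (s *\<^sub>R (y - x)) d)) (at 0)"
      by (rule has_derivative_compose[rotated])
    then show ?thesis
      by (simp add: has_field_derivative_def inner_commute mult_commute_abs)
  qed
  ultimately show ?thesis
    using convex_on_imp_above_tangent[of UNIV ?h 0 1] by force
qed

theorem corollary2:
  fixes X :: "'a::euclidean_space set"
    and Z U :: "'b::euclidean_space set"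
    and M :: "'a \<Rightarrow> 'b"
    and f :: "'a \<Rightarrow> real" and gradf :: "'a \<Rightarrow> 'a" and Hf :: "'a \<Rightarrow> 'a \<Rightarrow>\<^sub>L 'a"
    and g :: "'b \<Rightarrow> real"
    and \<rho> Lhat :: real
    and Hhat E \<Theta> :: "nat \<Rightarrow> 'a \<Rightarrow>\<^sub>L 'a"
    and \<gamma> \<epsilon>x \<epsilon>z \<zeta> :: "nat \<Rightarrow> real"
    and x :: "nat \<Rightarrow> 'a" and z u :: "nat \<Rightarrow> 'b"
    and xs :: 'a and zs us :: 'b
    and \<theta>max \<theta>min pstar :: real
    and \<tau>\<zeta> \<E>\<zeta> \<E>x \<E>z dxH dx dz du :: real
  assumes X: "closed X" "convex X"
    and Z: "closed Z" "convex Z"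
    and U: "closed U" "convex U"
    and M: "linear M"
    and \<rho>: "\<rho> > 0"
    and f_convex: "convex_on UNIV f"
    and f_smooth: "\<exists>L. L-lipschitz_on UNIV gradf"
    and f_C2: "twice_cont_diff f gradf Hf"
    and f_rel_smooth: "rel_smooth X Lhat f gradf Hf"
    and pstar: "pstar = optimal_value X Z M f g"
    and Hhat: "\<forall>k\<ge>1. psd (Hhat k)"
    and E: "\<forall>k\<ge>1. E k = Hhat k - Hf (x k)"
    and \<gamma>: "\<forall>k\<ge>1. \<gamma> k = norm (E k)"
    and \<Theta>: "\<forall>k\<ge>1. \<Theta> k = Lhat *\<^sub>R (Hhat k + \<gamma> k *\<^sub>R id_blinfun)"
    and run: "geni_admm_run \<rho> X Z M gradf g \<Theta> \<epsilon>x \<epsilon>z x z u"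
    and init: "u 1 = 0" "M (x 1) = z 1"
    and optimal: "optimal_solution X Z M f g xs zs"
    and saddle: "saddle_point \<rho> X Z U M f g xs zs us"
    and g_convex: "convex_on UNIV g"
    and g_lsc: "lower_semicontinuous g"
    and \<epsilon>x_summable: "summable (\<lambda>k. \<epsilon>x (k + 1))"
    and \<epsilon>z_summable: "summable (\<lambda>k. sqrt (\<epsilon>z (k + 1)))"
    and \<E>x: "\<E>x = (\<Sum>k. \<epsilon>x (k + 1))"
    and \<E>z: "\<E>z = (\<Sum>k. sqrt (\<epsilon>z (k + 1)))"
    and \<theta>: "\<theta>max > 0" "\<theta>min > 0"
    and \<Theta>_bounds: "\<forall>k\<ge>1. \<Theta> k \<preceq>\<^sub>L \<theta>max *\<^sub>R id_blinfun \<and> \<theta>min *\<^sub>R id_blinfun \<preceq>\<^sub>L \<Theta> k"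
    and \<zeta>_nonneg: "\<forall>k\<ge>1. 0 \<le> \<zeta> k"
    and \<zeta>_summable: "summable (\<lambda>k. \<zeta> (k + 1))"
    and \<Theta>_change: "\<forall>k\<ge>2. wnorm_sq (\<Theta> k) (x k - xs)
                              \<le> (1 + \<zeta> (k - 1)) * wnorm_sq (\<Theta> (k - 1)) (x k - xs)"
    and \<tau>\<zeta>: "\<tau>\<zeta> = (\<Prod>k. 1 + \<zeta> (k + 2))"
    and \<E>\<zeta>: "\<E>\<zeta> = \<tau>\<zeta> * (\<Sum>k. \<zeta> (k + 1))"
    and dxH: "dxH = wnorm (Hf (x 1)) (x 1 - xs)"
    and dx: "dx = norm (x 1 - xs)"
    and dz: "dz = norm (z 1 - zs)"
    and du: "du = norm (u 1 - us)"
  shows "\<exists>Cx Cz C\<zeta>. Cx > 0 \<and> Cz > 0 \<and> C\<zeta> > 0 \<and>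
    (let \<Gamma> = Lhat * (dxH\<^sup>2 + norm (E 1) * dx\<^sup>2) + \<rho> / 2 * dz\<^sup>2
                + Cx * \<E>x + Cz * \<E>z + C\<zeta> * \<E>\<zeta>
     in \<forall>t::nat. t \<ge> 1 \<longrightarrow>
          f (ergodic_avg x t) + g (ergodic_avg z t) - pstar \<le> \<Gamma> / real t \<and>
          norm (M (ergodic_avg x t) - ergodic_avg z t) \<le> 2 / real t * sqrt (\<Gamma> / \<rho> + du\<^sup>2))"
proof -

  \<comment> \<open>The saddle point and basic bounds on the data\<close>
  have feas: "M xs = zs" and pstar_eq: "pstar = f xs + g zs"
  proof -
    have opt: "(xs, zs) \<in> feasible_set X Z M"
      "\<And>a b. (a, b) \<in> feasible_set X Z M \<Longrightarrow> f xs + g zs \<le> f a + g b"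
      using optimal by (auto simp: optimal_solution_def is_arg_min_linorder)
    then show "M xs = zs" by (simp add: feasible_set_def)
    show "pstar = f xs + g zs"
      unfolding pstar optimal_value_def using opt by (intro cInf_eq_minimum) force+
  qed
  have mem: "xs \<in> X" "zs \<in> Z" using saddle by (simp_all add: saddle_point_def)
  \<comment> \<open>The minimizing half of the saddle property: at \<open>(xs, zs)\<close>
    feasibility kills the multiplier term, so the Lagrangian there equals
    \<open>pstar\<close>.\<close>
  have gap_nonneg: "0 \<le> f a + g b - pstar + \<rho> * inner us (M a - b)" if "a \<in> X" "b \<in> Z" for a b
    using saddle that feas unfolding saddle_point_def lagrangian_def pstar_eq by fastforce
  have Lhat: "0 < Lhat" using f_rel_smooth by (simp add: rel_smooth_def)
  obtain L where lip: "L-lipschitz_on UNIV gradf" using f_smooth by blast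
  obtain m where m: "0 \<le> m" "\<And>v. norm (M v) \<le> m * norm v"
    using linear_bounded_pos[OF M] by (metis less_imp_le)
  have xX: "x k \<in> X" and zZ: "z k \<in> Z" if "1 \<le> k" for k
    using run that unfolding geni_admm_run_def by (cases "k = 1"; force dest: spec[of _ "k - 1"])+
  have \<epsilon>0: "0 \<le> \<epsilon>x k" "0 \<le> \<epsilon>z k" if "1 \<le> k" for k
    using run that by (simp_all add: geni_admm_run_def)
  have u_step: "u (k + 1) = u k + (M (x (k + 1)) - z (k + 1))" if "1 \<le> k" for k
    using run that unfolding geni_admm_run_def by (simp add: add_diff_eq)
  have \<Theta>k: "psd (\<Theta> k)" "wnorm_sq (\<Theta> k) v \<le> \<theta>max * (norm v)\<^sup>2"
    "\<theta>min * (norm v)\<^sup>2 \<le> wnorm_sq (\<Theta> k) v" if "1 \<le> k" for k v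
    using \<Theta>_bounds that \<theta>(2) by (auto intro: loewner_scaled_id_bounds)
  have \<Theta>0: "0 \<le> wnorm_sq (\<Theta> k) v" if "1 \<le> k" for k v
    using \<Theta>k(1)[OF that] by (simp add: psd_def wnorm_sq_def)
  have \<Theta>_eq: "wnorm_sq (\<Theta> k) v = Lhat * (wnorm_sq (Hhat k) v + norm (E k) * (norm v)\<^sup>2)"
    and Hhat_near: "\<bar>wnorm_sq (Hhat k) v - wnorm_sq (Hf (x k)) v\<bar> \<le> norm (E k) * (norm v)\<^sup>2"
    if "1 \<le> k" for k v
  proof -
    show "wnorm_sq (\<Theta> k) v = Lhat * (wnorm_sq (Hhat k) v + norm (E k) * (norm v)\<^sup>2)"
      using \<Theta> \<gamma> that by (simp add: wnorm_sq_def blinfun.add_left blinfun.scaleR_left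
          inner_add_right power2_norm_eq_inner)
    show "\<bar>wnorm_sq (Hhat k) v - wnorm_sq (Hf (x k)) v\<bar> \<le> norm (E k) * (norm v)\<^sup>2"
      using abs_wnorm_sq_diff_le[of "Hhat k" v "Hf (x k)"] E that by simp
  qed
  \<comment> \<open>A single term of a nonnegative series is at most its sum; these are the uniform
    caps on the inexactness.\<close>
  have \<epsilon>x_le: "\<epsilon>x k \<le> \<E>x" and s_le: "sqrt (\<epsilon>z k) \<le> \<E>z" if "1 \<le> k" for k
  proof -
    have "(\<Sum>i\<in>{k - 1}. \<epsilon>x (i + 1)) \<le> \<E>x" "(\<Sum>i\<in>{k - 1}. sqrt (\<epsilon>z (i + 1))) \<le> \<E>z"
      unfolding \<E>x \<E>z using \<epsilon>0 \<epsilon>x_summable \<epsilon>z_summable by (intro sum_le_suminf; simp)+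
    then show "\<epsilon>x k \<le> \<E>x" "sqrt (\<epsilon>z k) \<le> \<E>z" using that by simp_all
  qed
  have \<E>0: "0 \<le> \<E>x" "0 \<le> \<E>z"
    using \<epsilon>x_le[of 1] s_le[of 1] \<epsilon>0[of 1] real_sqrt_ge_zero[of "\<epsilon>z 1"] by linarith+

  \<comment> \<open>The one-step inequality for the Lagrangian gap\<close>
  define N where "N k = 1 + norm (x k - xs) + norm (z k - zs) + norm (u k - us)
      + norm (x (k + 1) - xs)" for k
  \<comment> \<open>The coefficient in \<open>x_step_error_bound\<close> for
    \<open>B = \<E>x\<close> and \<open>\<theta> = \<theta>max\<close>.\<close>
  define C where "C = (norm (gradf xs) + L) + \<theta>max * (\<E>x + 1)
      + \<rho> * m * (m * \<E>x + m + 1 + norm us) + \<theta>max + \<rho> * m * m"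
  define err where "err k = C * N k * \<epsilon>x k
      + (sqrt (2 * \<rho>) * norm (z (k + 1) - zs) + \<E>z) * sqrt (\<epsilon>z k)" for k
  \<comment> \<open>The Lagrangian of iterate \<open>k + 1\<close> at the multiplier
    \<open>v\<close>, minus \<open>pstar\<close>. Leaving \<open>v\<close> free allows both 0 and
    \<open>us\<close> later.\<close>
  define gap where "gap k v = f (x (k + 1)) + g (z (k + 1)) - pstar
      + \<rho> * inner v (M (x (k + 1)) - z (k + 1))" for k v
  have C0: "0 \<le> C"
    unfolding C_def using lipschitz_on_nonneg[OF lip] \<theta> \<rho> m(1) \<E>0
    by (intro add_nonneg_nonneg mult_nonneg_nonneg) auto
  have step: "gap k v \<le> 1 / 2 * wnorm_sq (\<Theta> k) (x k - xs) - 1 / 2 * wnorm_sq (\<Theta> k) (x (k + 1) - xs)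
      + \<rho> / 2 * ((norm (z k - zs))\<^sup>2 - (norm (z (k + 1) - zs))\<^sup>2)
      + \<rho> / 2 * ((norm (u k - v))\<^sup>2 - (norm (u (k + 1) - v))\<^sup>2) + err k" if k: "1 \<le> k" for k v
  proof -
    obtain xe where xe: "is_arg_min (x_objective \<rho> M gradf (\<Theta> k) (x k) (z k) (u k)) (\<lambda>v. v \<in> X) xe"
      "norm (x (k + 1) - xe) \<le> \<epsilon>x k"
      using run k unfolding geni_admm_run_def by blast
    obtain ze where ze: "is_arg_min (z_objective \<rho> M g (x (k + 1)) (u k)) (\<lambda>v. v \<in> Z) ze"
      "z_objective \<rho> M g (x (k + 1)) (u k) (z (k + 1))
        \<le> z_objective \<rho> M g (x (k + 1)) (u k) ze + \<epsilon>z k"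
      using run k unfolding geni_admm_run_def by blast
    let ?d = "x (k + 1) - x k"
    have "f (x (k + 1)) \<le> f (x k) + inner (gradf (x k)) ?d + Lhat / 2 * wnorm_sq (Hf (x k)) ?d"
      using f_rel_smooth xX[of k] xX[of "k + 1"] k by (simp add: rel_smooth_def)
    \<comment> \<open>The shift by \<open>norm (E k)\<close> in \<open>\<Theta> k\<close>
      compensates the error of the Hessian approximation, so relative smoothness carries over to the
      weight \<open>\<Theta> k\<close>.\<close>
    moreover have "Lhat * wnorm_sq (Hf (x k)) ?d \<le> wnorm_sq (\<Theta> k) ?d"
      unfolding \<Theta>_eq[OF k] using Hhat_near[OF k, of ?d] Lhat by (intro mult_left_mono) auto
    ultimately have smooth: "f (x (k + 1)) \<le> f (x k) + inner (gradf (x k)) ?d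
        + 1 / 2 * wnorm_sq (\<Theta> k) ?d" by simp
    have grad: "f (x k) + inner (gradf (x k)) (xs - x k) \<le> f xs"
      using f_C2 by (intro convex_on_gradient_inequality f_convex) (simp add: twice_cont_diff_def)
    note xstep = x_step_inequality[OF M X(2) \<Theta>k(1)[OF k] xe(1) mem(1), of f "x (k + 1)",
        OF smooth grad]
    note xerr = x_step_error_bound[OF M m(2,1) \<Theta>k(1,2)[OF k] less_imp_le[OF \<theta>(1)] lip
        less_imp_le[OF \<rho>] xe(2) \<epsilon>x_le[OF k] feas, of "x k" "z k" "u k" us,
        folded N_def C_def]
    note zstep = z_step_inequality[OF g_convex Z(2) \<rho> ze(1) zZ mem(2) ze(2)]
    \<comment> \<open>One square root is traded for its cap, so that all \<open>z\<close>-errors are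
      multiples of the summable \<open>sqrt (\<epsilon>z k)\<close>.\<close>
    have "\<epsilon>z k \<le> \<E>z * sqrt (\<epsilon>z k)"
      using mult_right_mono[OF s_le[OF k], of "sqrt (\<epsilon>z k)"] \<epsilon>0(2)[OF k] by simp
    then have zerr: "sqrt (2 * \<rho> * \<epsilon>z k) * norm (z (k + 1) - zs) + \<epsilon>z k
        \<le> (sqrt (2 * \<rho>) * norm (z (k + 1) - zs) + \<E>z) * sqrt (\<epsilon>z k)"
      by (simp add: real_sqrt_mult ring_distribs mult_ac)
    \<comment> \<open>These rewritings bring the coupling terms of the \<open>x\<close>- and
      \<open>z\<close>-steps into the shape of \<open>admm_multiplier_inequality\<close>.\<close>
    have r: "M (x (k + 1) - xs) = (M (x (k + 1)) - z (k + 1)) + (z (k + 1) - zs)"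
      "M (x (k + 1)) - z k + u k = u (k + 1) + z (k + 1) - z k"
      "u k + M (x (k + 1)) - z (k + 1) = u (k + 1)"
      using u_step[OF k] by (simp_all add: linear_diff[OF M] feas)
    note mult = admm_multiplier_inequality[OF less_imp_le[OF \<rho>] u_step[OF k], of "z (k + 1)" "z k" zs v]
    show ?thesis
      using xstep xerr zstep zerr mult k unfolding r err_def gap_def pstar_eq by simp
  qed

  \<comment> \<open>The potential and the distances it controls\<close>
  define \<Phi> where "\<Phi> k v = 1 / 2 * wnorm_sq (\<Theta> k) (x k - xs) + \<rho> / 2 * (norm (z k - zs))\<^sup>2
      + \<rho> / 2 * (norm (u k - v))\<^sup>2" for k v
  \<comment> \<open>Iterate \<open>k + 1\<close> still measured in the weight
    \<open>\<Theta> k\<close>, as one step delivers it; \<open>\<Phi>_Suc\<close> pays a term in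
    \<open>\<zeta> k\<close> for changing the weight.\<close>
  define \<Phi>' where "\<Phi>' k v = 1 / 2 * wnorm_sq (\<Theta> k) (x (k + 1) - xs)
      + \<rho> / 2 * (norm (z (k + 1) - zs))\<^sup>2 + \<rho> / 2 * (norm (u (k + 1) - v))\<^sup>2" for k v
  \<comment> \<open>The first summand recovers the plain norm from half the weighted square, the
    second undoes the factor \<open>\<rho> / 2\<close>.\<close>
  define \<kappa> where "\<kappa> = 2 / \<theta>min + 2 / \<rho>"
  have \<kappa>0: "0 \<le> \<kappa>" using \<theta> \<rho> by (simp add: \<kappa>_def)
  have \<kappa>: "a \<le> \<kappa> * (1 / 2 * A + \<rho> / 2 * b + \<rho> / 2 * c)" "b \<le> \<kappa> * (1 / 2 * A + \<rho> / 2 * b + \<rho> / 2 * c)"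
      "c \<le> \<kappa> * (1 / 2 * A + \<rho> / 2 * b + \<rho> / 2 * c)"
    if "0 \<le> a" "0 \<le> b" "0 \<le> c" "\<theta>min * a \<le> A" for a b c A
  proof -
    have A0: "0 \<le> A" using that \<theta> mult_nonneg_nonneg[of \<theta>min a] by linarith
    have "a \<le> A / \<theta>min" using that \<theta> by (simp add: field_simps)
    moreover have "\<kappa> * (1 / 2 * A + \<rho> / 2 * b + \<rho> / 2 * c)
        = A / \<theta>min + A / \<rho> + \<rho> / \<theta>min * (b + c) + b + c"
      using \<theta> \<rho> by (simp add: \<kappa>_def field_simps)
    moreover have "0 \<le> A / \<theta>min" "0 \<le> A / \<rho>" "0 \<le> \<rho> / \<theta>min * (b + c)"
      using A0 that \<theta> \<rho> by auto
    ultimately show "a \<le> \<kappa> * (1 / 2 * A + \<rho> / 2 * b + \<rho> / 2 * c)"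
      "b \<le> \<kappa> * (1 / 2 * A + \<rho> / 2 * b + \<rho> / 2 * c)"
      "c \<le> \<kappa> * (1 / 2 * A + \<rho> / 2 * b + \<rho> / 2 * c)" using that by linarith+
  qed
  have sq_\<Phi>: "(norm (x k - xs))\<^sup>2 \<le> \<kappa> * \<Phi> k us" "(norm (z k - zs))\<^sup>2 \<le> \<kappa> * \<Phi> k us"
    "(norm (u k - us))\<^sup>2 \<le> \<kappa> * \<Phi> k us" if "1 \<le> k" for k
    unfolding \<Phi>_def by (rule \<kappa>[OF _ _ _ \<Theta>k(3)[OF that]]; simp)+
  have sq_\<Phi>': "(norm (x (k + 1) - xs))\<^sup>2 \<le> \<kappa> * \<Phi>' k us" "(norm (z (k + 1) - zs))\<^sup>2 \<le> \<kappa> * \<Phi>' k us"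
    if "1 \<le> k" for k
    unfolding \<Phi>'_def by (rule \<kappa>[OF _ _ _ \<Theta>k(3)[OF that]]; simp)+
  \<comment> \<open>The errors are linear in the distances while the potential is quadratic; this
    bridges the two.\<close>
  have le_sq: "a \<le> 1 + a\<^sup>2" for a :: real
    using zero_le_power2[of "a - 1/2"] by (simp add: power2_diff power_divide)
  have \<Phi>0: "0 \<le> \<Phi> k v" "0 \<le> \<Phi>' k v" if "1 \<le> k" for k v
    using \<Theta>0[OF that] \<rho> by (simp_all add: \<Phi>_def \<Phi>'_def)
  have \<Phi>_Suc: "\<Phi> (k + 1) v \<le> \<Phi>' k v + \<zeta> k * (1 / 2 * wnorm_sq (\<Theta> k) (x (k + 1) - xs))"
    if "1 \<le> k" for k v
    using \<Theta>_change[rule_format, of "k + 1"] that by (simp add: \<Phi>_def \<Phi>'_def algebra_simps)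
  have gap_le: "gap k v \<le> \<Phi> k v - \<Phi>' k v + err k" if "1 \<le> k" for k v
    using step[OF that, of v] by (simp add: \<Phi>_def \<Phi>'_def algebra_simps)

  \<comment> \<open>Uniform boundedness of the iterates\<close>
  \<comment> \<open>Bounding the four norms in \<open>N k\<close> by \<open>le_sq\<close> leaves the
    constant 5; three of them are controlled by \<open>\<Phi>\<close> and one by
    \<open>\<Phi>'\<close>, whose joint bound is \<open>3 * \<kappa> * S\<close>.\<close>
  define K where "K = C * (5 + 3 * \<kappa>) + sqrt (2 * \<rho>) * (1 + \<kappa>) + \<E>z"
  have K0: "0 \<le> K" using C0 \<kappa>0 \<E>0 \<rho> by (simp add: K_def)
  have err_le: "err k \<le> K * (\<epsilon>x k + sqrt (\<epsilon>z k)) * S"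
    if k: "1 \<le> k" and S_def: "S = \<Phi> k us + 1 + (\<Phi>' k us + 1)" for k S
  proof -
    have S1: "1 \<le> S" unfolding S_def using \<Phi>0[OF k, of us] by linarith
    have "\<kappa> * \<Phi> k us + \<kappa> * \<Phi>' k us \<le> \<kappa> * S" using \<kappa>0 by (simp add: S_def ring_distribs)
    moreover have "0 \<le> \<kappa> * \<Phi> k us" "0 \<le> \<kappa> * \<Phi>' k us" using \<Phi>0[OF k] \<kappa>0 by simp_all
    moreover note le_sq[of "norm (x k - xs)"] le_sq[of "norm (z k - zs)"]
      le_sq[of "norm (u k - us)"] le_sq[of "norm (x (k + 1) - xs)"]
      le_sq[of "norm (z (k + 1) - zs)"] sq_\<Phi>[OF k] sq_\<Phi>'[OF k] S1
    ultimately have "N k \<le> 5 * S + 3 * (\<kappa> * S)" "norm (z (k + 1) - zs) \<le> S + \<kappa> * S"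
      unfolding N_def by linarith+
    then have Nk: "N k \<le> (5 + 3 * \<kappa>) * S" and zk: "norm (z (k + 1) - zs) \<le> (1 + \<kappa>) * S"
      by (simp_all add: ring_distribs)
    have "C * N k * \<epsilon>x k \<le> C * ((5 + 3 * \<kappa>) * S) * \<epsilon>x k"
      using C0 Nk \<epsilon>0[OF k] by (intro mult_right_mono mult_left_mono) auto
    also have "\<dots> \<le> K * S * \<epsilon>x k"
      unfolding mult.assoc[symmetric]
      using \<epsilon>0[OF k] S1 \<E>0 \<kappa>0 \<rho> by (intro mult_right_mono) (auto simp: K_def)
    finally have e1: "C * N k * \<epsilon>x k \<le> K * S * \<epsilon>x k" .
    have "sqrt (2 * \<rho>) * norm (z (k + 1) - zs) + \<E>z \<le> sqrt (2 * \<rho>) * ((1 + \<kappa>) * S) + \<E>z * S"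
      using mult_left_mono[OF S1 \<E>0(2)] zk \<rho> by (intro add_mono mult_left_mono) auto
    also have "\<dots> = (sqrt (2 * \<rho>) * (1 + \<kappa>) + \<E>z) * S" by (simp add: distrib_right mult.assoc)
    also have "\<dots> \<le> K * S" using S1 C0 \<kappa>0 by (intro mult_right_mono) (auto simp: K_def)
    finally have "(sqrt (2 * \<rho>) * norm (z (k + 1) - zs) + \<E>z) * sqrt (\<epsilon>z k)
        \<le> K * S * sqrt (\<epsilon>z k)"
      using \<epsilon>0[OF k] by (intro mult_right_mono) auto
    moreover have "K * (\<epsilon>x k + sqrt (\<epsilon>z k)) * S = K * S * \<epsilon>x k + K * S * sqrt (\<epsilon>z k)"
      by (simp only: distrib_left distrib_right[of "\<epsilon>x k"] mult_ac)
    ultimately show ?thesis using e1 unfolding err_def by linarith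
  qed
  have \<Phi>'_le: "\<Phi>' k us + 1 \<le> \<Phi> k us + 1
      + K * (\<epsilon>x k + sqrt (\<epsilon>z k)) * (\<Phi> k us + 1 + (\<Phi>' k us + 1))" if k: "1 \<le> k" for k
  proof -
    have "0 \<le> gap k us" unfolding gap_def using xX[of "k + 1"] zZ[of "k + 1"] by (intro gap_nonneg) auto
    then show ?thesis using gap_le[OF k, of us] err_le[OF k refl] by linarith
  qed
  have \<Phi>_Suc_le: "\<Phi> (k + 1) us + 1 \<le> (1 + \<zeta> k) * (\<Phi>' k us + 1)" if k: "1 \<le> k" for k
  proof -
    have \<zeta>0: "0 \<le> \<zeta> k" using \<zeta>_nonneg k by simp
    have "1 / 2 * wnorm_sq (\<Theta> k) (x (k + 1) - xs) \<le> \<Phi>' k us" using \<rho> by (simp add: \<Phi>'_def)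
    from mult_left_mono[OF this \<zeta>0] have "\<Phi> (k + 1) us \<le> \<Phi>' k us + \<zeta> k * \<Phi>' k us"
      using \<Phi>_Suc[OF k, of us] by linarith
    then show ?thesis using \<zeta>0 by (simp add: algebra_simps)
  qed
  have "summable (\<lambda>k. K * (\<epsilon>x (k + 1) + sqrt (\<epsilon>z (k + 1))))"
    by (intro summable_mult summable_add \<epsilon>x_summable \<epsilon>z_summable)
  \<comment> \<open>The iteration counts from 1 and the recursion lemma from 0, hence the shifted
    index in every sequence.\<close>
  then have "\<exists>B. \<forall>k. \<Phi> (k + 1) us + 1 \<le> B"
    using \<Phi>0[of "k + 1" us for k] \<epsilon>0[of "k + 1" for k] \<zeta>_nonneg K0 \<Phi>'_le[of "k + 1" for k]
      \<Phi>_Suc_le[of "k + 1" for k]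
    by (intro perturbed_recursion_bounded[where P = "\<lambda>k. \<Phi>' (k + 1) us + 1"
          and \<delta> = "\<lambda>k. K * (\<epsilon>x (k + 1) + sqrt (\<epsilon>z (k + 1)))", OF _ _ _ _ _ \<zeta>_summable])
      (auto intro: add_nonneg_nonneg)
  then obtain B where B: "\<And>k. \<Phi> (k + 1) us + 1 \<le> B" by blast
  have B0: "0 \<le> B" using B[of 0] \<Phi>0(1)[of 1 us] by simp
  have \<Phi>B: "\<kappa> * \<Phi> k us \<le> \<kappa> * B" if "1 \<le> k" for k
    using B[of "k - 1"] \<kappa>0 that by (intro mult_left_mono) auto
  define R where "R = 1 + \<kappa> * B"
  have R0: "0 \<le> R" using \<kappa>0 B0 by (simp add: R_def)
  have R: "norm (x k - xs) \<le> R" "norm (z k - zs) \<le> R" "norm (u k - us) \<le> R" if "1 \<le> k" for k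
    unfolding R_def
    using \<Phi>B[OF that] sq_\<Phi>[OF that] le_sq[of "norm (x k - xs)"] le_sq[of "norm (z k - zs)"]
      le_sq[of "norm (u k - us)"] by linarith+

  \<comment> \<open>Telescoping with summable errors\<close>
  \<comment> \<open>With all distances at most \<open>R\<close>, these bound the coefficients of the
    three kinds of error. They depend on \<open>B\<close> and the data but not on \<open>t\<close>;
    the final \<open>+ 1\<close> makes them strictly positive.\<close>
  define Cx Cz C\<zeta> where "Cx = C * (1 + 4 * R) + 1" and "Cz = sqrt (2 * \<rho>) * R + \<E>z + 1"
    and "C\<zeta> = 1 / 2 * (\<theta>max * (\<kappa> * B)) + 1"
  have pos: "0 < Cx" "0 < Cz" "0 < C\<zeta>"
    unfolding Cx_def Cz_def C\<zeta>_def using C0 R0 \<E>0 \<theta> \<kappa>0 B0 \<rho>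
    by (auto intro!: add_nonneg_pos)
  have gap_telescope: "gap k v \<le> \<Phi> k v - \<Phi> (k + 1) v
      + (Cx * \<epsilon>x k + Cz * sqrt (\<epsilon>z k) + C\<zeta> * \<zeta> k)" if k: "1 \<le> k" for k v
  proof -
    have "N k \<le> 1 + 4 * R" unfolding N_def using R[OF k] R(1)[of "k + 1"] by simp
    then have "C * N k \<le> Cx" unfolding Cx_def using mult_left_mono[OF _ C0] by fastforce
    then have 1: "C * N k * \<epsilon>x k \<le> Cx * \<epsilon>x k" using \<epsilon>0[OF k] by (intro mult_right_mono)
    have "sqrt (2 * \<rho>) * norm (z (k + 1) - zs) \<le> sqrt (2 * \<rho>) * R"
      using R(2)[of "k + 1"] \<rho> by (intro mult_left_mono) auto
    then have 2: "(sqrt (2 * \<rho>) * norm (z (k + 1) - zs) + \<E>z) * sqrt (\<epsilon>z k) \<le> Cz * sqrt (\<epsilon>z k)"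
      using \<epsilon>0[OF k] by (intro mult_right_mono) (auto simp: Cz_def)
    have "(norm (x (k + 1) - xs))\<^sup>2 \<le> \<kappa> * B"
      using sq_\<Phi>(1)[of "k + 1"] \<Phi>B[of "k + 1"] by simp
    from mult_left_mono[OF this less_imp_le[OF \<theta>(1)]]
    have "1 / 2 * wnorm_sq (\<Theta> k) (x (k + 1) - xs) \<le> C\<zeta>"
      using \<Theta>k(2)[OF k, of "x (k + 1) - xs"] unfolding C\<zeta>_def by linarith
    then have "\<zeta> k * (1 / 2 * wnorm_sq (\<Theta> k) (x (k + 1) - xs)) \<le> C\<zeta> * \<zeta> k"
      using \<zeta>_nonneg k by (subst mult.commute) (intro mult_right_mono; simp)
    then show ?thesis
      using 1 2 gap_le[OF k, of v] \<Phi>_Suc[OF k, of v] unfolding err_def by linarith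
  qed

  \<comment> \<open>Summation and the constant \<Gamma>\<close>
  have \<tau>1: "1 \<le> \<tau>\<zeta>"
  proof -
    have "summable (\<lambda>k. \<zeta> (k + 2))"
      using summable_ignore_initial_segment[OF \<zeta>_summable, of 1] by simp
    then have "summable (\<lambda>k. norm (1 + \<zeta> (k + 2) - 1))" using \<zeta>_nonneg by simp
    then have "convergent_prod (\<lambda>k. 1 + \<zeta> (k + 2))"
      by (intro abs_convergent_prod_imp_convergent_prod summable_imp_abs_convergent_prod)
    \<comment> \<open>All factors are at least 1, so the infinite product is at least the empty
      partial product.\<close>
    from convergent_prod_has_prod[OF this] have "prod (\<lambda>k. 1 + \<zeta> (k + 2)) {..<0} \<le> \<tau>\<zeta>"
      unfolding \<tau>\<zeta> using \<zeta>_nonneg by (intro prod_le_prodinf) (auto intro: add_nonneg_nonneg)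
    then show ?thesis by simp
  qed
  have \<zeta>_sum: "(\<Sum>k<t. \<zeta> (k + 1)) \<le> \<E>\<zeta>" for t
  proof -
    have "(\<Sum>k<t. \<zeta> (k + 1)) \<le> (\<Sum>k. \<zeta> (k + 1))"
      using \<zeta>_nonneg by (intro sum_le_suminf \<zeta>_summable) auto
    moreover have "0 \<le> (\<Sum>k. \<zeta> (k + 1))" using \<zeta>_nonneg by (intro suminf_nonneg \<zeta>_summable) auto
    ultimately show ?thesis
      unfolding \<E>\<zeta> using mult_right_mono[OF \<tau>1, of "\<Sum>k. \<zeta> (k + 1)"] by simp
  qed
  define \<Gamma> where "\<Gamma> = Lhat * (dxH\<^sup>2 + norm (E 1) * dx\<^sup>2) + \<rho> / 2 * dz\<^sup>2
                + Cx * \<E>x + Cz * \<E>z + C\<zeta> * \<E>\<zeta>"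
  have initial: "1 / 2 * wnorm_sq (\<Theta> 1) (x 1 - xs) \<le> Lhat * (dxH\<^sup>2 + norm (E 1) * dx\<^sup>2)"
  proof -
    \<comment> \<open>The real \<open>sqrt\<close> is an odd function, so squaring
      \<open>wnorm\<close> gives the absolute value of the form. Below, \<open>Hhat 1\<close>
      exceeds the Hessian by at most \<open>norm (E 1)\<close>, and the factor 1/2 offsets the
      resulting double count of that norm.\<close>
    have "dxH\<^sup>2 = \<bar>wnorm_sq (Hf (x 1)) (x 1 - xs)\<bar>"
      by (simp add: dxH wnorm_def flip: real_sqrt_power)
    then have "1 / 2 * (wnorm_sq (Hhat 1) (x 1 - xs) + norm (E 1) * dx\<^sup>2)
        \<le> dxH\<^sup>2 + norm (E 1) * dx\<^sup>2"
      using abs_le_D1[OF Hhat_near[OF order_refl, of "x 1 - xs"]]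
        abs_ge_self[of "wnorm_sq (Hf (x 1)) (x 1 - xs)"]
        abs_ge_zero[of "wnorm_sq (Hf (x 1)) (x 1 - xs)"] unfolding dx by argo
    from mult_left_mono[OF this less_imp_le[OF Lhat]] show ?thesis
      using \<Theta>_eq[of 1] by (simp add: dx)
  qed
  \<comment> \<open>The initial multiplier term depends on \<open>v\<close> and is therefore kept
    apart from \<Gamma>.\<close>
  have gap_sum: "(\<Sum>k<t. gap (k + 1) v) + \<Phi> (t + 1) v \<le> \<Gamma> + \<rho> / 2 * (norm (u 1 - v))\<^sup>2" for t v
  proof -
    have "(\<Sum>k<t. gap (k + 1) v) + \<Phi> (t + 1) v \<le> \<Phi> 1 v + (Cx * (\<Sum>k<t. \<epsilon>x (k + 1))
        + Cz * (\<Sum>k<t. sqrt (\<epsilon>z (k + 1))) + C\<zeta> * (\<Sum>k<t. \<zeta> (k + 1)))"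
    proof (induction t)
      case (Suc t)
      then show ?case using gap_telescope[of "t + 1" v] by (simp add: distrib_left)
    qed simp
    moreover have "(\<Sum>k<t. \<epsilon>x (k + 1)) \<le> \<E>x" "(\<Sum>k<t. sqrt (\<epsilon>z (k + 1))) \<le> \<E>z"
      unfolding \<E>x \<E>z using \<epsilon>0 \<epsilon>x_summable \<epsilon>z_summable by (intro sum_le_suminf; simp)+
    then have "Cx * (\<Sum>k<t. \<epsilon>x (k + 1)) \<le> Cx * \<E>x"
      "Cz * (\<Sum>k<t. sqrt (\<epsilon>z (k + 1))) \<le> Cz * \<E>z" "C\<zeta> * (\<Sum>k<t. \<zeta> (k + 1)) \<le> C\<zeta> * \<E>\<zeta>"
      using pos \<zeta>_sum[of t] by (auto intro: mult_left_mono)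
    ultimately show ?thesis using initial unfolding \<Gamma>_def \<Phi>_def dz by linarith
  qed

  \<comment> \<open>The two bounds at the averages\<close>
  have "f (ergodic_avg x t) + g (ergodic_avg z t) - pstar \<le> \<Gamma> / real t"
    and "norm (M (ergodic_avg x t) - ergodic_avg z t) \<le> 2 / real t * sqrt (\<Gamma> / \<rho> + du\<^sup>2)"
    if t: "t \<ge> 1" for t
  proof -
    have t0: "0 < real t" using t by simp
    have "f (ergodic_avg x t) + g (ergodic_avg z t) - pstar
        \<le> 1 / real t * (\<Sum>k<t. f (x (k + 2))) + 1 / real t * (\<Sum>k<t. g (z (k + 2))) - pstar"
      using convex_on_ergodic_avg[OF f_convex t] convex_on_ergodic_avg[OF g_convex t]
      by (intro diff_right_mono add_mono)
    \<comment> \<open>At \<open>v = 0\<close> the gap is the plain objective gap, and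
      \<open>u 1 = 0\<close> makes the initial multiplier term vanish.\<close>
    also have "\<dots> = (\<Sum>k<t. gap (k + 1) 0) / real t"
      using t0 by (simp add: gap_def sum.distrib sum_subtractf field_simps)
    also have "\<dots> \<le> \<Gamma> / real t"
      using gap_sum[of 0 t] \<Phi>0(1)[of "t + 1" 0] t0 init by (intro divide_right_mono) auto
    finally show "f (ergodic_avg x t) + g (ergodic_avg z t) - pstar \<le> \<Gamma> / real t" .

    have "0 \<le> gap (k + 1) us" for k
      unfolding gap_def using xX[of "k + 2"] zZ[of "k + 2"] by (intro gap_nonneg) auto
    then have "0 \<le> (\<Sum>k<t. gap (k + 1) us)" by (intro sum_nonneg) auto
    moreover have "\<rho> / 2 * (norm (u (t + 1) - us))\<^sup>2 \<le> \<Phi> (t + 1) us"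
      using \<Theta>0[of "t + 1"] \<rho> by (simp add: \<Phi>_def)
    ultimately have "\<rho> / 2 * (norm (u (t + 1) - us))\<^sup>2 \<le> \<Gamma> + \<rho> / 2 * du\<^sup>2"
      using gap_sum[of us t] unfolding du by linarith
    then have b: "(norm (u (t + 1) - us))\<^sup>2 \<le> 2 * (\<Gamma> / \<rho>) + du\<^sup>2"
      using \<rho> by (simp add: field_simps)
    \<comment> \<open>Squaring the sum, rather than adding two square roots, balances the terms: the
      bound \<open>b\<close> then yields exactly four times
      \<open>\<Gamma> / \<rho> + du\<^sup>2\<close>, hence the factor 2.\<close>
    have "(norm (u (t + 1) - us) + du)\<^sup>2 \<le> 2 * ((norm (u (t + 1) - us))\<^sup>2 + du\<^sup>2)"
      using zero_le_power2[of "norm (u (t + 1) - us) - du"] by (simp add: power2_eq_square algebra_simps)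
    also have "\<dots> \<le> 2\<^sup>2 * (\<Gamma> / \<rho> + du\<^sup>2)" using b by simp
    finally have "norm (u (t + 1) - us) + du \<le> sqrt (2\<^sup>2 * (\<Gamma> / \<rho> + du\<^sup>2))" by (rule real_le_rsqrt)
    also have "\<dots> = 2 * sqrt (\<Gamma> / \<rho> + du\<^sup>2)"
      by (simp only: real_sqrt_mult real_sqrt_abs abs_numeral)
    finally have nu: "norm (u (t + 1) - u 1) \<le> 2 * sqrt (\<Gamma> / \<rho> + du\<^sup>2)"
      using norm_triangle_ineq4[of "u (t + 1) - us" "u 1 - us"] by (simp add: du)
    \<comment> \<open>Each residual is an increment of the multiplier, so the averaged residual is a
      total increment divided by \<open>t\<close>.\<close>
    have "(\<Sum>k<t. M (x (k + 2)) - z (k + 2)) = u (t + 1) - u 1"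
    proof (induction t)
      case (Suc t)
      then show ?case using u_step[of "t + 1"] by simp
    qed simp
    then have "M (ergodic_avg x t) - ergodic_avg z t = (1 / real t) *\<^sub>R (u (t + 1) - u 1)"
      by (simp only: ergodic_avg_eq linear_scale[OF M] linear_sum[OF M] sum_subtractf
          scaleR_diff_right[symmetric])
    then show "norm (M (ergodic_avg x t) - ergodic_avg z t) \<le> 2 / real t * sqrt (\<Gamma> / \<rho> + du\<^sup>2)"
      using divide_right_mono[OF nu less_imp_le[OF t0]] t0 by simp
  qed
  with pos show ?thesis
    unfolding Let_def by (intro exI[of _ Cx] exI[of _ Cz] exI[of _ C\<zeta>]) (simp add: \<Gamma>_def)
qed

end
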